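(* Let $G$ be a simple undirected graph on $n\ge 5$ vertices, and suppose that $G$ contains the complete graph $K_{n-3}$ as an induced subgraph. Then $\mathrm{mr}(\mathbb{F},G)\le 4$ for every field $\mathbb{F}$ with $|\mathbb{F}|>3$.
   Context: For a field $\mathbb{F}$ and a simple undirected graph $G$ with vertex set $\{1,\ldots,n\}$ and edge set $E$, let $\mathrm{S}(\mathbb{F},G)$ denote the set of all symmetric $n\times n$ matrices $A=[a_{ij}]$ over $\mathbb{F}$ such that, for all $i\neq j$, $a_{ij}\neq 0$ if and only if $ij\in E$; there is no restriction on the diagonal entries. The minimum rank of $G$ over $\mathbb{F}$ is $\mathrm{mr}(\mathbb{F},G)=\min\{\operatorname{rank}A : A\in \mathrm{S}(\mathbb{F},G)\}$. *)

theory Defs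
  imports "Graph_Theory.Graph_Theory" "Jordan_Normal_Form.DL_Rank"
begin

text \<open>
  A simple undirected graph is a \<^locale>\<open>pair_graph\<close>: finite, loopless, with a symmetric arc set,
  so that an edge \<open>ij\<close> is the pair of arcs \<open>(i, j)\<close>, \<open>(j, i)\<close>. Vertices are numbered
  \<open>0, ..., n - 1\<close>, as are the rows and columns of a matrix.
\<close>

definition graph_mats :: "nat pair_pre_digraph \<Rightarrow> 'a::field mat set" where
  "graph_mats G = {A \<in> carrier_mat (card (pverts G)) (card (pverts G)).
     A\<^sup>T = A \<and>
     (\<forall>i < card (pverts G). \<forall>j < card (pverts G). i \<noteq> j \<longrightarrow> (A $$ (i, j) \<noteq> 0 \<longleftrightarrow> (i, j) \<in> parcs G))}"

text \<open>The field cannot be read off the graph, so it is passed as a type argument.\<close>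

definition min_rank :: "'a::field itself \<Rightarrow> nat pair_pre_digraph \<Rightarrow> nat" where
  "min_rank F G = (LEAST r. \<exists>A \<in> (graph_mats G :: 'a mat set). vec_space.rank (card (pverts G)) A = r)"

lemma graph_mats_nonempty:
  assumes "pair_graph G"
  shows "(graph_mats G :: 'a::field mat set) \<noteq> {}"
proof -
  interpret pair_graph G by fact
  let ?n = "card (pverts G)"
  let ?A = "mat ?n ?n (\<lambda>(i, j). if (i, j) \<in> parcs G then 1 else 0) :: 'a mat"
  have "(i, j) \<in> parcs G \<longleftrightarrow> (j, i) \<in> parcs G" for i j
    using pair_sym_arcs by (auto simp: symmetric_def dest: symD)
  hence "?A \<in> graph_mats G"
    by (auto simp: graph_mats_def intro!: eq_matI)
  thus ?thesis by blast
qed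

lemma min_rank_attained:
  assumes "pair_graph G"
  shows "\<exists>A \<in> (graph_mats G :: 'a::field mat set).
    vec_space.rank (card (pverts G)) A = min_rank TYPE('a) G"
proof -
  from graph_mats_nonempty[OF assms] obtain A :: "'a mat" where "A \<in> graph_mats G" by blast
  hence "\<exists>r. \<exists>A \<in> (graph_mats G :: 'a mat set). vec_space.rank (card (pverts G)) A = r" by blast
  thus ?thesis unfolding min_rank_def by (rule LeastI_ex)
qed

lemma min_rank_le:
  assumes "(A :: 'a::field mat) \<in> graph_mats G"
  shows "min_rank TYPE('a) G \<le> vec_space.rank (card (pverts G)) A"
  unfolding min_rank_def using assms by (blast intro: Least_le)

end

theory Submission
  imports Defs
begin

text \<open>
  Let \<open>v 0\<close>, \<open>v 1\<close>, \<open>v 2\<close> be the vertices outside the clique, \<open>C\<close> an invertible symmetric matrix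
  with the pattern of the graph they induce, \<open>Q\<close> its inverse, and let the columns of \<open>N\<close> be the
  0-1 vectors recording which \<open>v a\<close> a clique vertex is adjacent to. The block matrix with blocks
  \<open>C\<close>, \<open>N\<close>, \<open>N\<^sup>T\<close>, \<open>N\<^sup>T Q N + t J\<close>, where \<open>J\<close> is the all-ones matrix, has rank at most
  \<open>3 + 1\<close>, and it fits the graph as soon as \<open>- t\<close> is not a value of \<open>Q\<close> at two 0-1 vectors.
  For each of the four graphs on three vertices there is an integral \<open>C\<close> of determinant \<open>\<plusminus>1\<close> such
  that \<open>Q\<close> takes only the values \<open>-1, 0, 1, 2\<close> there. In a field with more than three elements
  these never exhaust the field: if they did, then \<open>3\<close> would be one of them, which makes two of
  them equal.
\<close>

text \<open>Every summand is an outer product, hence of rank at most 1, and rank is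
  subadditive.\<close>

lemma (in vec_space) rank_sum_products_le:
  fixes f g :: "nat \<Rightarrow> nat \<Rightarrow> 'a"
  shows "rank (mat n nc (\<lambda>(i, j). \<Sum>a<k. f a i * g a j)) \<le> k"
proof (induction k)
  case 0
  have "mat n nc (\<lambda>(i, j). \<Sum>a<0. f a i * g a j) = 0\<^sub>m n nc"
    by (intro eq_matI) auto
  thus ?case by (simp only: rank_0I le_refl)
next
  case (Suc k)
  let ?A = "mat n nc (\<lambda>(i, j). \<Sum>a<k. f a i * g a j)"
  let ?B = "mat n nc (\<lambda>(i, j). f k i * g k j)"
  have "mat n nc (\<lambda>(i, j). \<Sum>a<Suc k. f a i * g a j) = ?A + ?B"
    by (intro eq_matI) auto
  moreover have "rank (?A + ?B) \<le> rank ?A + rank ?B"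
    by (intro rank_subadditive) auto
  moreover have "rank ?B \<le> 1"
    by (rule rank_le_1_product_entries[where f = "f k" and g = "g k"]) auto
  ultimately show ?case using Suc.IH by simp
qed

text \<open>With P the matrix whose rows are \<open>p i\<close>, all four blocks come from the one
  formula P Q P^T + t w w^T. Since Q C = I, the blocks meeting \<open>X\<close> are the prescribed
  ones; \<open>t\<close> only has to keep the clique block free of off-diagonal zeros.\<close>

lemma min_rank_le_clique_complement:
  fixes C Q :: "nat \<Rightarrow> nat \<Rightarrow> 'a::field" and v :: "nat \<Rightarrow> nat" and t :: 'a
  assumes G: "pair_graph G" "pverts G = {0..<n}"
    and inj: "inj_on v {..<r}"
    and clique: "\<And>i j. \<lbrakk>i < n; j < n; i \<notin> v ` {..<r}; j \<notin> v ` {..<r}; i \<noteq> j\<rbrakk> \<Longrightarrow> (i, j) \<in> parcs G"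
    and C: "\<And>a b. \<lbrakk>a < r; b < r; a \<noteq> b\<rbrakk> \<Longrightarrow> C a b \<noteq> 0 \<longleftrightarrow> (v a, v b) \<in> parcs G"
    and symC: "\<And>a b. \<lbrakk>a < r; b < r\<rbrakk> \<Longrightarrow> C a b = C b a"
    and symQ: "\<And>a b. \<lbrakk>a < r; b < r\<rbrakk> \<Longrightarrow> Q a b = Q b a"
    and inv: "\<And>a c. \<lbrakk>a < r; c < r\<rbrakk> \<Longrightarrow> (\<Sum>b<r. Q a b * C b c) = of_bool (a = c)"
    and t: "\<And>x y. range x \<subseteq> {0, 1} \<Longrightarrow> range y \<subseteq> {0, 1} \<Longrightarrow>
              (\<Sum>a<r. x a * (\<Sum>b<r. Q a b * y b)) \<noteq> - t"
  shows "min_rank TYPE('a) G \<le> Suc r"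
proof -
  interpret pair_graph G by fact
  have arc_sym: "(i, j) \<in> parcs G \<longleftrightarrow> (j, i) \<in> parcs G" for i j
    using pair_sym_arcs by (auto simp: symmetric_def dest: symD)
  define X where "X = v ` {..<r}"
  define p where "p i a = (if i \<in> X then C (the_inv_into {..<r} v i) a
      else of_bool ((i, v a) \<in> parcs G))" for i a
  define w :: "nat \<Rightarrow> 'a" where "w i = of_bool (i \<notin> X)" for i
  \<comment> \<open>Indices below \<open>r\<close> carry P and Q P^T; index \<open>r\<close> carries
    the rank-one correction t w w^T.\<close>
  define f where "f a i = (if a < r then p i a else t * w i)" for a i
  define g where "g a i = (if a < r then \<Sum>b<r. Q a b * p i b else w i)" for a i
  define h where "h i j = (\<Sum>a<Suc r. f a i * g a j)" for i j
  define A where "A = mat n n (\<lambda>(i, j). h i j)"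
  have h: "h i j = (\<Sum>a<r. p i a * (\<Sum>b<r. Q a b * p j b)) + t * w i * w j" for i j
    by (simp add: h_def f_def g_def)
  have pv: "p (v c) b = C c b" if "c < r" for b c
    using that inj by (simp add: p_def X_def the_inv_into_f_f)
  have h_sym: "h i j = h j i" for i j
  proof -
    have "(\<Sum>a<r. p i a * (\<Sum>b<r. Q a b * p j b)) = (\<Sum>a<r. \<Sum>b<r. p i a * Q a b * p j b)"
      by (simp add: sum_distrib_left mult.assoc)
    also have "\<dots> = (\<Sum>b<r. \<Sum>a<r. p i a * Q a b * p j b)"
      by (rule sum.swap)
    also have "\<dots> = (\<Sum>b<r. p j b * (\<Sum>a<r. Q b a * p i a))"
      unfolding sum_distrib_left by (intro sum.cong refl) (simp add: symQ mult_ac)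
    finally show ?thesis by (simp add: h mult_ac)
  qed
  \<comment> \<open>By symmetry, row \<open>v c\<close> of P is column \<open>c\<close> of
    \<open>C\<close>, which \<open>Q\<close> turns into a unit vector; the correction vanishes
    because \<open>w\<close> is 0 on \<open>X\<close>.\<close>
  have h_v: "h i (v c) = p i c" if "c < r" for i c
  proof -
    have "(\<Sum>b<r. Q a b * p (v c) b) = of_bool (a = c)" if "a < r" for a
    proof -
      have "(\<Sum>b<r. Q a b * p (v c) b) = (\<Sum>b<r. Q a b * C b c)"
        by (intro sum.cong refl) (use \<open>c < r\<close> symC in \<open>simp add: pv\<close>)
      thus ?thesis using inv[OF that \<open>c < r\<close>] by simp
    qed
    hence "h i (v c) = (\<Sum>a<r. p i a * of_bool (a = c)) + t * w i * w (v c)"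
      unfolding h by simp
    also have "w (v c) = 0" using that by (simp add: w_def X_def)
    also have "(\<Sum>a<r. p i a * of_bool (a = c)) = p i c"
      using that by (simp add: of_bool_def if_distrib cong: if_cong)
    finally show ?thesis by simp
  qed
  have h_X: "h i j \<noteq> 0 \<longleftrightarrow> (i, j) \<in> parcs G" if ij: "i \<noteq> j" "j \<in> X" for i j
  proof -
    obtain c where c: "c < r" "j = v c" using ij by (auto simp: X_def)
    show ?thesis
    proof (cases "i \<in> X")
      case True
      then obtain d where "d < r" "i = v d" by (auto simp: X_def)
      thus ?thesis using c ij C[of d c] by (auto simp: h_v pv)
    next
      case False
      thus ?thesis using c by (simp add: h_v) (simp add: p_def)
    qed
  qed
  have pattern: "h i j \<noteq> 0 \<longleftrightarrow> (i, j) \<in> parcs G" if ij: "i < n" "j < n" "i \<noteq> j" for i j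
  proof -
    consider "j \<in> X" | "i \<in> X" | "i \<notin> X" "j \<notin> X" by blast
    thus ?thesis
    proof cases
      case 1
      thus ?thesis using ij h_X by simp
    next
      case 2
      thus ?thesis using ij h_X[of j i] h_sym[of i j] arc_sym[of i j] by simp
    next
      \<comment> \<open>Both vertices lie in the clique, so the entry has to be nonzero;
        \<open>p i\<close> and \<open>p j\<close> are 0-1 vectors, and the choice of
        \<open>t\<close> rules out cancellation.\<close>
      case 3
      hence "range (p i) \<subseteq> {0, 1}" "range (p j) \<subseteq> {0, 1}"
        by (auto simp: p_def)
      hence "h i j \<noteq> 0" using t[of "p i" "p j"] 3
        by (auto simp: h w_def eq_neg_iff_add_eq_0)
      thus ?thesis using clique[of i j] 3 ij by (auto simp: X_def)
    qed
  qed
  have "A\<^sup>T = A"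
    by (intro eq_matI) (auto simp: A_def h_sym)
  hence "A \<in> graph_mats G"
    using pattern G(2) by (simp add: graph_mats_def A_def)
  hence "min_rank TYPE('a) G \<le> vec_space.rank n A"
    using min_rank_le G(2) by fastforce
  also have "\<dots> \<le> Suc r"
    unfolding A_def h_def by (rule vec_space.rank_sum_products_le)
  finally show ?thesis .
qed

text \<open>
  The implications on \<open>p\<close>, \<open>q\<close>, \<open>s\<close> leave one labelling of each graph on three vertices.
\<close>

lemma three_vertex_form:
  assumes "s \<longrightarrow> q" "q \<longrightarrow> p"
  obtains C Q :: "nat \<Rightarrow> nat \<Rightarrow> 'a::field"
  where "\<And>a b. \<lbrakk>a < 3; b < 3\<rbrakk> \<Longrightarrow> C a b = C b a"
    and "\<And>a b. \<lbrakk>a < 3; b < 3\<rbrakk> \<Longrightarrow> Q a b = Q b a"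
    and "C 0 1 \<noteq> 0 \<longleftrightarrow> p" "C 1 2 \<noteq> 0 \<longleftrightarrow> q" "C 0 2 \<noteq> 0 \<longleftrightarrow> s"
    and "\<And>a c. \<lbrakk>a < 3; c < 3\<rbrakk> \<Longrightarrow> (\<Sum>b<3. Q a b * C b c) = of_bool (a = c)"
    and "\<And>x y. range x \<subseteq> {0, 1} \<Longrightarrow> range y \<subseteq> {0, 1} \<Longrightarrow>
           (\<Sum>a<3. x a * (\<Sum>b<3. Q a b * y b)) \<in> {-1, 0, 1, 2}"
proof -
  have lt3: "a < 3 \<longleftrightarrow> a = 0 \<or> a = 1 \<or> a = 2" for a :: nat by auto
  have sum3: "sum F {..<3} = F 0 + F 1 + F 2" for F :: "nat \<Rightarrow> 'a"
    by (simp add: numeral_3_eq_3 numeral_2_eq_2)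
  note form = that
  \<comment> \<open>Only the arguments 0, 1, 2 of \<open>x\<close> and \<open>y\<close> matter, so
    the condition on values becomes a check of 64 cases for a concrete matrix.\<close>
  have thesis_if: thesis
    if entries: "\<And>a b. \<lbrakk>a < 3; b < 3\<rbrakk> \<Longrightarrow> L ! a ! b = L ! b ! a"
        "\<And>a b. \<lbrakk>a < 3; b < 3\<rbrakk> \<Longrightarrow> K ! a ! b = K ! b ! a"
        "L ! 0 ! 1 \<noteq> 0 \<longleftrightarrow> p" "L ! 1 ! 2 \<noteq> 0 \<longleftrightarrow> q" "L ! 0 ! 2 \<noteq> 0 \<longleftrightarrow> s"
        "\<And>a c. \<lbrakk>a < 3; c < 3\<rbrakk> \<Longrightarrow>
          K ! a ! 0 * L ! 0 ! c + K ! a ! 1 * L ! 1 ! c + K ! a ! 2 * L ! 2 ! c = of_bool (a = c)"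
      and vals: "\<And>x0 x1 x2 y0 y1 y2 :: 'a. \<lbrakk>x0 = 0 \<or> x0 = 1; x1 = 0 \<or> x1 = 1; x2 = 0 \<or> x2 = 1;
          y0 = 0 \<or> y0 = 1; y1 = 0 \<or> y1 = 1; y2 = 0 \<or> y2 = 1\<rbrakk> \<Longrightarrow>
        x0 * (K ! 0 ! 0 * y0 + K ! 0 ! 1 * y1 + K ! 0 ! 2 * y2)
        + x1 * (K ! 1 ! 0 * y0 + K ! 1 ! 1 * y1 + K ! 1 ! 2 * y2)
        + x2 * (K ! 2 ! 0 * y0 + K ! 2 ! 1 * y1 + K ! 2 ! 2 * y2) \<in> {-1, 0, 1, 2}"
    for L K :: "'a list list"
  proof (rule form[where C = "\<lambda>a b. L ! a ! b" and Q = "\<lambda>a b. K ! a ! b"])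
    fix x y :: "nat \<Rightarrow> 'a" assume "range x \<subseteq> {0, 1}" "range y \<subseteq> {0, 1}"
    hence "x a = 0 \<or> x a = 1" "y a = 0 \<or> y a = 1" for a by blast+
    thus "(\<Sum>a<3. x a * (\<Sum>b<3. K ! a ! b * y b)) \<in> {-1, 0, 1, 2}"
      unfolding sum3 by (intro vals)
  qed (use entries in \<open>simp_all add: sum3\<close>)
  consider "\<not> p" "\<not> q" "\<not> s" | "p" "\<not> q" "\<not> s" | "p" "q" "\<not> s" | "p" "q" "s"
    using assms by blast
  thus ?thesis
  proof cases
    case 1
    show ?thesis
    \<comment> \<open>A matrix that is its own inverse. The entry -1 keeps the values at most 2; the
      identity would reach 3.\<close>
    proof (rule thesis_if[where L = "[[1, 0, 0], [0, 1, 0], [0, 0, -1]]" and K = "[[1, 0, 0], [0, 1, 0], [0, 0, -1]]"], goal_cases)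
      case (7 x0 x1 x2 y0 y1 y2)
      thus ?case by (elim disjE) simp_all
    qed (use 1 in \<open>auto simp: lt3\<close>)
  next
    case 2
    show ?thesis
    \<comment> \<open>Again its own inverse: a swap on the edge, -1 at the isolated vertex.\<close>
    proof (rule thesis_if[where L = "[[0, 1, 0], [1, 0, 0], [0, 0, -1]]" and K = "[[0, 1, 0], [1, 0, 0], [0, 0, -1]]"], goal_cases)
      case (7 x0 x1 x2 y0 y1 y2)
      thus ?case by (elim disjE) simp_all
    qed (use 2 in \<open>auto simp: lt3\<close>)
  next
    case 3
    show ?thesis
    \<comment> \<open>Index 1 is the middle of the path. The determinant of \<open>L\<close> is -1,
      so the integral inverse \<open>K\<close> works in every characteristic.\<close>
    proof (rule thesis_if[where L = "[[1, 1, 0], [1, 1, 1], [0, 1, 0]]" and K = "[[1, 0, -1], [0, 0, 1], [-1, 1, 0]]"], goal_cases)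
      case (7 x0 x1 x2 y0 y1 y2)
      thus ?case by (elim disjE) simp_all
    qed (use 3 in \<open>auto simp: lt3\<close>)
  next
    case 4
    show ?thesis
    \<comment> \<open>The diagonal is chosen to give determinant -1. Its entry 2 vanishes in
      characteristic 2, harmlessly, since the diagonal is unrestricted.\<close>
    proof (rule thesis_if[where L = "[[2, 1, 1], [1, 0, 1], [1, 1, 1]]" and K = "[[1, 0, -1], [0, -1, 1], [-1, 1, 1]]"], goal_cases)
      case (7 x0 x1 x2 y0 y1 y2)
      thus ?case by (elim disjE) simp_all
    qed (use 4 in \<open>auto simp: lt3\<close>)
  qed
qed

lemma field_avoids_minus_one_to_two:
  assumes "infinite (UNIV :: 'a::field set) \<or> card (UNIV :: 'a set) > 3"
  obtains t :: "'a::field" where "- t \<notin> {-1, 0, 1, 2}"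
proof -
  have "(UNIV :: 'a set) \<noteq> {-1, 0, 1, 2}"
  proof
    assume UNIV: "(UNIV :: 'a set) = {-1, 0, 1, 2}"
    hence "(3 :: 'a) \<in> {-1, 0, 1, 2}" by blast
    then consider "(3 :: 'a) = -1" | "(3 :: 'a) = 0" | "(3 :: 'a) = 1" | "(3 :: 'a) = 2" by blast
    \<comment> \<open>Either way 2 repeats another listed value. The case 3 = -1 gives 2 * 2 = 0,
      and 3 = 2 is impossible since it gives 1 = 0.\<close>
    hence "(2 :: 'a) = 0 \<or> (2 :: 'a) = -1"
    proof cases
      case 1
      hence "(2 :: 'a) * 2 = 0" by (simp add: eq_neg_iff_add_eq_0)
      thus ?thesis by (metis mult_eq_0_iff)
    next
      case 2
      thus ?thesis by (simp add: eq_neg_iff_add_eq_0)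
    next
      case 3
      hence "(2 :: 'a) + 1 = 0 + 1" by simp
      thus ?thesis by (simp only: add_right_cancel) simp
    next
      case 4
      hence "(2 :: 'a) + 1 = 2 + 0" by simp
      thus ?thesis by (simp only: add_left_cancel) simp
    qed
    hence "UNIV = {-1, 0, 1 :: 'a}" using UNIV by auto
    moreover have "card {-1, 0, 1 :: 'a} \<le> 3"
      by (simp add: card_insert_if)
    \<comment> \<open>Since \<open>card\<close> is 0 on infinite sets, the size hypothesis has two
      disjuncts; a universe of at most three elements refutes both.\<close>
    ultimately show False using assms finite.emptyI by (metis finite.insertI not_le)
  qed
  then obtain u :: 'a where "u \<notin> {-1, 0, 1, 2}" by blast
  thus ?thesis using that[of "- u"] by simp
qed

text \<open>With no or all pairs related any order will do; a single related pair becomes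
  \<open>x\<close>, \<open>y\<close>; the common element of two related pairs becomes
  \<open>y\<close>. This provides the labelling that \<open>three_vertex_form\<close>
  expects.\<close>

lemma three_set_sorted_by_symmetric_relation:
  assumes "card X = 3" and sym: "\<And>x y. R x y \<longleftrightarrow> R y x"
  obtains x y z where "X = {x, y, z}" "x \<noteq> y" "y \<noteq> z" "x \<noteq> z"
    "R x z \<longrightarrow> R y z" "R y z \<longrightarrow> R x y"
proof -
  obtain a b c where abc: "X = {a, b, c}" "a \<noteq> b" "b \<noteq> c" "a \<noteq> c"
    using assms(1) by (auto simp: card_3_iff)
  have "\<exists>x y z. X = {x, y, z} \<and> x \<noteq> y \<and> y \<noteq> z \<and> x \<noteq> z \<and> (R x z \<longrightarrow> R y z) \<and> (R y z \<longrightarrow> R x y)"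
    if "X = {u, v, w}" "u \<noteq> v" "v \<noteq> w" "u \<noteq> w" "R u w \<longrightarrow> R v w" "R v w \<longrightarrow> R u v" for u v w
    using that by blast
  note this[of a b c] this[of a c b] this[of b a c] this[of b c a] this[of c a b] this[of c b a]
  hence "\<exists>x y z. X = {x, y, z} \<and> x \<noteq> y \<and> y \<noteq> z \<and> x \<noteq> z \<and> (R x z \<longrightarrow> R y z) \<and> (R y z \<longrightarrow> R x y)"
    using abc sym[of a b] sym[of b c] sym[of a c] by (auto simp: insert_commute)
  thus ?thesis using that by blast
qed

theorem theorem6p1:
  fixes G :: "nat pair_pre_digraph" and n :: nat
  assumes "pair_graph G" and "pverts G = {0..<n}" and "n \<ge> 5"
    and "\<exists>H :: nat pair_pre_digraph.
           induced_subgraph (with_proj H) (with_proj G) \<and> complete_digraph (n - 3) (with_proj H)"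
    and "infinite (UNIV :: 'a::field set) \<or> card (UNIV :: 'a set) > 3"
  shows "min_rank TYPE('a) G \<le> 4"
proof -
  interpret pair_graph G by fact
  have arc_sym: "(i, j) \<in> parcs G \<longleftrightarrow> (j, i) \<in> parcs G" for i j
    using pair_sym_arcs by (auto simp: symmetric_def dest: symD)
  obtain H :: "nat pair_pre_digraph" where
    H: "induced_subgraph (with_proj H) (with_proj G)" "complete_digraph (n - 3) (with_proj H)"
    using assms(4) by blast
  have sub: "pverts H \<subseteq> {0..<n}" "parcs H \<subseteq> parcs G"
    using H(1) assms(2) by (auto simp: induced_subgraph_def subgraph_def)
  have complete: "finite (pverts H)" "card (pverts H) = n - 3"
    "parcs H = {(u, v). u \<in> pverts H \<and> v \<in> pverts H \<and> u \<noteq> v}"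
    using H(2) by (auto simp: complete_digraph_pair_def)
  \<comment> \<open>As \<open>n \<ge> 5\<close>, the subtraction \<open>n - 3\<close> on naturals is
    exact.\<close>
  have "card ({0..<n} - pverts H) = 3"
    using sub complete assms(3) by (simp add: card_Diff_subset)
  then obtain x y z where xyz: "{0..<n} - pverts H = {x, y, z}" "x \<noteq> y" "y \<noteq> z" "x \<noteq> z"
    "(x, z) \<in> parcs G \<longrightarrow> (y, z) \<in> parcs G" "(y, z) \<in> parcs G \<longrightarrow> (x, y) \<in> parcs G"
    by (rule three_set_sorted_by_symmetric_relation[where R = "\<lambda>i j. (i, j) \<in> parcs G"])
       (rule arc_sym, rule that)
  obtain C Q :: "nat \<Rightarrow> nat \<Rightarrow> 'a" where
    symC: "\<And>a b. \<lbrakk>a < 3; b < 3\<rbrakk> \<Longrightarrow> C a b = C b a"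
    and symQ: "\<And>a b. \<lbrakk>a < 3; b < 3\<rbrakk> \<Longrightarrow> Q a b = Q b a"
    and C: "C 0 1 \<noteq> 0 \<longleftrightarrow> (x, y) \<in> parcs G" "C 1 2 \<noteq> 0 \<longleftrightarrow> (y, z) \<in> parcs G"
      "C 0 2 \<noteq> 0 \<longleftrightarrow> (x, z) \<in> parcs G"
    and inv: "\<And>a c. \<lbrakk>a < 3; c < 3\<rbrakk> \<Longrightarrow> (\<Sum>b<3. Q a b * C b c) = of_bool (a = c)"
    and vals: "\<And>x y. range x \<subseteq> {0, 1} \<Longrightarrow> range y \<subseteq> {0, 1} \<Longrightarrow>
           (\<Sum>a<3. x a * (\<Sum>b<3. Q a b * y b)) \<in> {-1, 0, 1, 2}"
    by (rule three_vertex_form[OF xyz(5,6)]) (rule that)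
  obtain t :: 'a where t: "- t \<notin> {-1, 0, 1, 2}"
    using field_avoids_minus_one_to_two[OF assms(5)] by blast
  define v where "v a = [x, y, z] ! a" for a
  have lt3: "a < 3 \<longleftrightarrow> a = 0 \<or> a = 1 \<or> a = 2" for a :: nat by auto
  have v: "v ` {..<3} = {x, y, z}"
    by (simp add: v_def lessThan_nat_numeral lessThan_Suc insert_commute)
  have "min_rank TYPE('a) G \<le> Suc 3"
  proof (rule min_rank_le_clique_complement[OF assms(1,2), where v = v and C = C and Q = Q and t = t])
    show "inj_on v {..<3}"
      using xyz by (auto simp: inj_on_def v_def lt3)
  next
    fix i j assume "i < n" "j < n" "i \<notin> v ` {..<3}" "j \<notin> v ` {..<3}" "i \<noteq> j"
    moreover from this have "i \<notin> {0..<n} - pverts H" "j \<notin> {0..<n} - pverts H"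
      unfolding v xyz(1) by blast+
    ultimately have "i \<in> pverts H" "j \<in> pverts H" by simp_all
    thus "(i, j) \<in> parcs G" using sub complete \<open>i \<noteq> j\<close> by blast
  next
    fix a b :: nat assume "a < 3" "b < 3" "a \<noteq> b"
    thus "C a b \<noteq> 0 \<longleftrightarrow> (v a, v b) \<in> parcs G"
      using C symC[of 0 1] symC[of 1 2] symC[of 0 2] arc_sym by (auto simp: lt3 v_def)
  next
    fix f g :: "nat \<Rightarrow> 'a" assume "range f \<subseteq> {0, 1}" "range g \<subseteq> {0, 1}"
    thus "(\<Sum>a<3. f a * (\<Sum>b<3. Q a b * g b)) \<noteq> - t" using vals[of f g] t by auto
  qed (use symC symQ inv in auto)
  thus ?thesis by simp
qed

end
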